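(* Let $\{S(t)\}_{t\ge0}$ be a twin semigroup on a norming dual pair $(Y,Y^\diamond)$. Assume that every sequentially continuous linear map $(Y^\diamond,\sigma(Y^\diamond,Y))\to\mathbb R$ is continuous. Let $q\in Y$ and let $F:[0,\infty)\to\mathbb R$ be of locally bounded variation. Then, for each $t>0$, there exists $u(t)\in Y$ such that for all $y^\diamond\in Y^\diamond$ $$\int_{[0,t]}y^\diamond S(t-\tau)q\;F(d\tau)=\langle y^\diamond,u(t)\rangle .$$
   Context: Banach spaces $Y,Y^\diamond$ (real) form a norming dual pair if there is a bilinear map $\langle\cdot,\cdot\rangle:Y^\diamond\times Y\to\mathbb R$ with $|\langle y^\diamond,y\rangle|\le M\|y^\diamond\|\|y\|$ for some $M\ge1$, $\|y\|=\sup\{|\langle y^\diamond,y\rangle|:\|y^\diamond\|\le1\}$ and $\|y^\diamond\|=\sup\{|\langle y^\diamond,y\rangle|:\|y\|\le1\}$. $\sigma(Y^\diamond,Y)$ is the weak topology on $Y^\diamond$ induced by $Y$. A twin operator $L$ is a bounded bilinear map $Y^\diamond\times Y\to\mathbb R$, $(y^\diamond,y)\mapsto y^\diamond Ly$, such that for each $y$ there is $Ly\in Y$ with $\langle y^\diamond,Ly\rangle=y^\diamond Ly$ for all $y^\diamond$, and for each $y^\diamond$ there is $y^\diamond L\in Y^\diamond$ with $\langle y^\diamond L,y\rangle=y^\diamond Ly$ for all $y$. Composition: $y^\diamond L_1L_2y:=\langle y^\diamond L_1,L_2y\rangle$. A twin semigroup is a family $\{S(t)\}_{t\ge0}$ of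 twin operators with: (i) $S(0)=I$, $S(t+s)=S(t)S(s)$; (ii) $|y^\diamond S(t)y|\le Me^{\omega t}\|y\|\|y^\diamond\|$ for some $M\ge1,\omega\in\mathbb R$; (iii) $t\mapsto y^\diamond S(t)y$ is Borel measurable for all $y,y^\diamond$; (iv) for $\operatorname{Re}\lambda>\omega$ there is a twin operator $\overline S(\lambda)$ (on the complexification if $\lambda$ is non-real) with $y^\diamond\overline S(\lambda)y=\int_0^\infty e^{-\lambda t}y^\diamond S(t)y\,dt$. Functions of locally bounded variation are normalized: $F(0)=0$ and $F$ right-continuous on $(0,\infty)$; $F(d\tau)$ is the Lebesgue–Stieltjes (Radon) measure on $[0,\infty)$ that assigns $F(t)$ to $[0,t]$ for $t>0$. *)

theory Defs
  imports "HOL-Analysis.Analysis"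
begin

section \<open>Norming dual pairs and twin operators\<close>

definition norming_dual_pair :: "('d::banach \<Rightarrow> 'y::banach \<Rightarrow> real) \<Rightarrow> bool" where
  "norming_dual_pair p \<longleftrightarrow>
     bilinear p \<and>
     (\<exists>M\<ge>1. \<forall>d y. \<bar>p d y\<bar> \<le> M * norm d * norm y) \<and>
     (\<forall>y. norm y = (SUP d\<in>{d. norm d \<le> 1}. \<bar>p d y\<bar>)) \<and>
     (\<forall>d. norm d = (SUP y\<in>{y. norm y \<le> 1}. \<bar>p d y\<bar>))"

definition weak_dual_topology :: "('d \<Rightarrow> 'y \<Rightarrow> real) \<Rightarrow> 'd topology" where
  "weak_dual_topology p = topology_generated_by {(\<lambda>d. p d y) -` U | y U. open U}"

definition sequentially_continuous :: "'a topology \<Rightarrow> ('a \<Rightarrow> real) \<Rightarrow> bool" where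
  "sequentially_continuous T f \<longleftrightarrow>
     (\<forall>x l. limitin T x l sequentially \<longrightarrow> (\<lambda>n. f (x n)) \<longlonglongrightarrow> f l)"

definition twin_operator ::
  "('d::real_normed_vector \<Rightarrow> 'y::real_normed_vector \<Rightarrow> real) \<Rightarrow> ('d \<Rightarrow> 'y \<Rightarrow> real) \<Rightarrow> bool" where
  "twin_operator p L \<longleftrightarrow>
     bounded_bilinear L \<and>
     (\<forall>y. \<exists>z. \<forall>d. p d z = L d y) \<and>
     (\<forall>d. \<exists>e. \<forall>y. p e y = L d y)"

text \<open>For a twin operator on a norming dual pair the following elements exist by definition and
  are unique because the pair separates points.\<close>

definition act_right :: "('d \<Rightarrow> 'y \<Rightarrow> real) \<Rightarrow> ('d \<Rightarrow> 'y \<Rightarrow> real) \<Rightarrow> 'y \<Rightarrow> 'y" where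
  "act_right p L y = (THE z. \<forall>d. p d z = L d y)"

definition act_left :: "('d \<Rightarrow> 'y \<Rightarrow> real) \<Rightarrow> ('d \<Rightarrow> 'y \<Rightarrow> real) \<Rightarrow> 'd \<Rightarrow> 'd" where
  "act_left p L d = (THE e. \<forall>y. p e y = L d y)"

definition twin_comp ::
  "('d \<Rightarrow> 'y \<Rightarrow> real) \<Rightarrow> ('d \<Rightarrow> 'y \<Rightarrow> real) \<Rightarrow> ('d \<Rightarrow> 'y \<Rightarrow> real) \<Rightarrow> ('d \<Rightarrow> 'y \<Rightarrow> real)" where
  "twin_comp p L1 L2 d y = p (act_left p L1 d) (act_right p L2 y)"

section \<open>Complexification\<close>

text \<open>The complexification of a real space is modelled by pairs: \<open>(a, b)\<close> stands for \<open>a + \<i> b\<close>.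
  The library norm on the product is equivalent to every reasonable complexification norm, so it
  yields the same bounded maps.\<close>

definition imul :: "'a::real_vector \<times> 'a \<Rightarrow> 'a \<times> 'a" where
  "imul x = (- snd x, fst x)"

definition complexify :: "('d \<Rightarrow> 'y \<Rightarrow> real) \<Rightarrow> 'd \<times> 'd \<Rightarrow> 'y \<times> 'y \<Rightarrow> complex" where
  "complexify b d y =
     Complex (b (fst d) (fst y) - b (snd d) (snd y)) (b (fst d) (snd y) + b (snd d) (fst y))"

definition complex_twin_operator ::
  "('d::real_normed_vector \<Rightarrow> 'y::real_normed_vector \<Rightarrow> real)
     \<Rightarrow> ('d \<times> 'd \<Rightarrow> 'y \<times> 'y \<Rightarrow> complex) \<Rightarrow> bool" where
  "complex_twin_operator p L \<longleftrightarrow>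
     bounded_bilinear L \<and>
     (\<forall>d y. L (imul d) y = \<i> * L d y \<and> L d (imul y) = \<i> * L d y) \<and>
     (\<forall>y. \<exists>z. \<forall>d. complexify p d z = L d y) \<and>
     (\<forall>d. \<exists>e. \<forall>y. complexify p e y = L d y)"

section \<open>Twin semigroups\<close>

text \<open>Only the values \<open>S t\<close> for \<open>t \<ge> 0\<close> are constrained. The identity twin operator is the
  pairing \<open>p\<close> itself.\<close>

definition twin_semigroup ::
  "('d::banach \<Rightarrow> 'y::banach \<Rightarrow> real) \<Rightarrow> (real \<Rightarrow> 'd \<Rightarrow> 'y \<Rightarrow> real) \<Rightarrow> bool" where
  "twin_semigroup p S \<longleftrightarrow>
     (\<forall>t\<ge>0. twin_operator p (S t)) \<and>
     S 0 = p \<and>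
     (\<forall>t\<ge>0. \<forall>s\<ge>0. S (t + s) = twin_comp p (S t) (S s)) \<and>
     (\<forall>d y. (\<lambda>t. S t d y) \<in> borel_measurable (restrict_space borel {0..})) \<and>
     (\<exists>M\<ge>1. \<exists>\<omega>.
        (\<forall>t\<ge>0. \<forall>d y. \<bar>S t d y\<bar> \<le> M * exp (\<omega> * t) * norm y * norm d) \<and>
        (\<forall>r>\<omega>. \<exists>R. twin_operator p R \<and>
           (\<forall>d y. R d y = (LINT t:{0..}|lborel. exp (- r * t) * S t d y))) \<and>
        (\<forall>z. Re z > \<omega> \<and> z \<notin> \<real> \<longrightarrow>
           (\<exists>R. complex_twin_operator p R \<and>
              (\<forall>d y. R d y =
                 (LINT t:{0..}|lborel. exp (- z * of_real t) * complexify (S t) d y)))))"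

section \<open>Lebesgue--Stieltjes integrals against functions of locally bounded variation\<close>

text \<open>A function on \<open>[0,\<infinity>)\<close> is represented by a function on the reals; only its values on
  \<open>[0,\<infinity>)\<close> matter.\<close>

definition variation_sums :: "(real \<Rightarrow> real) \<Rightarrow> real \<Rightarrow> real set" where
  "variation_sums F t =
     {(\<Sum>i<n. \<bar>F (x (Suc i)) - F (x i)\<bar>) | n x.
        0 \<le> x 0 \<and> x n \<le> t \<and> (\<forall>i<n. x i \<le> x (Suc i))}"

definition locally_bounded_variation :: "(real \<Rightarrow> real) \<Rightarrow> bool" where
  "locally_bounded_variation F \<longleftrightarrow> (\<forall>t\<ge>0. bdd_above (variation_sums F t))"

definition normalized_lbv :: "(real \<Rightarrow> real) \<Rightarrow> bool" where
  "normalized_lbv F \<longleftrightarrow>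
     locally_bounded_variation F \<and> F 0 = 0 \<and> (\<forall>t>0. continuous (at_right t) F)"

definition total_variation :: "(real \<Rightarrow> real) \<Rightarrow> real \<Rightarrow> real" where
  "total_variation F t = Sup (variation_sums F t)"

definition pos_variation :: "(real \<Rightarrow> real) \<Rightarrow> real \<Rightarrow> real" where
  "pos_variation F t = (total_variation F t + F t) / 2"

definition neg_variation :: "(real \<Rightarrow> real) \<Rightarrow> real \<Rightarrow> real" where
  "neg_variation F t = (total_variation F t - F t) / 2"

text \<open>The distribution function on the real line of the measure \<open>G(d\<tau>)\<close>, for nondecreasing \<open>G\<close> on
  \<open>[0,\<infinity>)\<close> with \<open>G(0) = 0\<close>. The infimum is the right limit \<open>G(t+)\<close>: at \<open>t = 0\<close> it produces the atom
  \<open>G(0+)\<close> at the origin, and where \<open>G\<close> is right-continuous it is \<open>G(t)\<close>.\<close>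

definition right_distribution :: "(real \<Rightarrow> real) \<Rightarrow> real \<Rightarrow> real" where
  "right_distribution G t = (if t < 0 then 0 else (INF s\<in>{t<..}. G s))"

definition stieltjes_pos :: "(real \<Rightarrow> real) \<Rightarrow> real measure" where
  "stieltjes_pos F = interval_measure (right_distribution (pos_variation F))"

definition stieltjes_neg :: "(real \<Rightarrow> real) \<Rightarrow> real measure" where
  "stieltjes_neg F = interval_measure (right_distribution (neg_variation F))"

text \<open>The measure \<open>F(d\<tau>)\<close> is signed, hence represented by its Jordan decomposition.\<close>

definition stieltjes_integral :: "(real \<Rightarrow> real) \<Rightarrow> real set \<Rightarrow> (real \<Rightarrow> real) \<Rightarrow> real" where
  "stieltjes_integral F A f = (LINT \<tau>:A|stieltjes_pos F. f \<tau>) - (LINT \<tau>:A|stieltjes_neg F. f \<tau>)"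

text \<open>The rest of this theory checks that the two measures are finite on \<open>[0,t]\<close>, vanish on the
  negative half-line, and that their difference assigns \<open>F t\<close> to \<open>[0,t]\<close> for \<open>t > 0\<close>.\<close>

lemma variation_sums_0: "0 \<le> t \<Longrightarrow> 0 \<in> variation_sums F t"
  unfolding variation_sums_def by (rule CollectI, rule exI[of _ 0], rule exI[of _ "\<lambda>_. 0"]) auto

lemma variation_sums_extend:
  assumes "v \<in> variation_sums F s" "s \<le> t"
  shows "\<exists>w\<in>variation_sums F t. v + \<bar>F t - F s\<bar> \<le> w"
proof -
  obtain n x where v: "v = (\<Sum>i<n. \<bar>F (x (Suc i)) - F (x i)\<bar>)"
    and x: "0 \<le> x 0" "x n \<le> s" "\<forall>i<n. x i \<le> x (Suc i)"
    using assms(1) unfolding variation_sums_def by auto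
  define y where "y = (\<lambda>i. if i \<le> n then x i else if i = Suc n then s else t)"
  let ?w = "\<Sum>i<Suc (Suc n). \<bar>F (y (Suc i)) - F (y i)\<bar>"
  have "(\<Sum>i<n. \<bar>F (y (Suc i)) - F (y i)\<bar>) = v"
    unfolding v by (rule sum.cong) (auto simp: y_def)
  then have "?w = v + \<bar>F s - F (x n)\<bar> + \<bar>F t - F s\<bar>"
    by (simp add: y_def)
  then have "v + \<bar>F t - F s\<bar> \<le> ?w" by linarith
  moreover have "?w \<in> variation_sums F t"
    unfolding variation_sums_def
  proof (rule CollectI, intro exI conjI)
    show "?w = ?w" ..
    show "0 \<le> y 0" "y (Suc (Suc n)) \<le> t" using x by (auto simp: y_def)
    show "\<forall>i<Suc (Suc n). y i \<le> y (Suc i)"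
      using x assms(2) by (auto simp: y_def less_Suc_eq)
  qed
  ultimately show ?thesis by blast
qed

lemma total_variation_diff:
  assumes "locally_bounded_variation F" "0 \<le> s" "s \<le> t"
  shows "total_variation F s + \<bar>F t - F s\<bar> \<le> total_variation F t"
proof -
  have bdd: "bdd_above (variation_sums F t)"
    using assms unfolding locally_bounded_variation_def by auto
  have "total_variation F s \<le> total_variation F t - \<bar>F t - F s\<bar>"
    unfolding total_variation_def[of F s]
  proof (rule cSup_least)
    show "variation_sums F s \<noteq> {}" using variation_sums_0[OF assms(2)] by blast
    fix v assume "v \<in> variation_sums F s"
    then obtain w where "w \<in> variation_sums F t" "v + \<bar>F t - F s\<bar> \<le> w"
      using variation_sums_extend assms(3) by blast
    moreover have "w \<le> total_variation F t"
      unfolding total_variation_def using bdd calculation(1) by (rule cSup_upper[rotated])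
    ultimately show "v \<le> total_variation F t - \<bar>F t - F s\<bar>" by linarith
  qed
  then show ?thesis by linarith
qed

lemma total_variation_0_nonneg:
  assumes "locally_bounded_variation F" shows "0 \<le> total_variation F 0"
  unfolding total_variation_def
proof (rule cSup_upper[OF variation_sums_0])
  show "bdd_above (variation_sums F 0)"
    using assms unfolding locally_bounded_variation_def by simp
qed simp

definition jordan_part :: "(real \<Rightarrow> real) \<Rightarrow> bool" where
  "jordan_part G \<longleftrightarrow> 0 \<le> G 0 \<and> mono_on {0..} G"

lemma jordan_part_pos_variation:
  assumes "normalized_lbv F" shows "jordan_part (pos_variation F)"
proof -
  have F: "locally_bounded_variation F" "F 0 = 0"
    using assms unfolding normalized_lbv_def by auto
  show ?thesis
    unfolding jordan_part_def
  proof (intro conjI mono_onI)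
    show "0 \<le> pos_variation F 0"
      using total_variation_0_nonneg[OF F(1)] F(2) by (simp add: pos_variation_def)
    fix s t :: real assume "s \<in> {0..}" "s \<le> t"
    then show "pos_variation F s \<le> pos_variation F t"
      using total_variation_diff[OF F(1), of s t] by (simp add: pos_variation_def)
  qed
qed

lemma jordan_part_neg_variation:
  assumes "normalized_lbv F" shows "jordan_part (neg_variation F)"
proof -
  have F: "locally_bounded_variation F" "F 0 = 0"
    using assms unfolding normalized_lbv_def by auto
  show ?thesis
    unfolding jordan_part_def
  proof (intro conjI mono_onI)
    show "0 \<le> neg_variation F 0"
      using total_variation_0_nonneg[OF F(1)] F(2) by (simp add: neg_variation_def)
    fix s t :: real assume "s \<in> {0..}" "s \<le> t"
    then show "neg_variation F s \<le> neg_variation F t"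
      using total_variation_diff[OF F(1), of s t] by (simp add: neg_variation_def)
  qed
qed

context
  fixes G :: "real \<Rightarrow> real"
  assumes G: "jordan_part G"
begin

lemma jordan_part_mono: "0 \<le> s \<Longrightarrow> s \<le> t \<Longrightarrow> G s \<le> G t"
  using G mono_onD[of "{0..}" G s t] unfolding jordan_part_def by simp

lemma jordan_part_nonneg: "0 \<le> t \<Longrightarrow> 0 \<le> G t"
  using G jordan_part_mono[of 0 t] unfolding jordan_part_def by linarith

lemma bdd_below_jordan_part: "0 \<le> t \<Longrightarrow> bdd_below (G ` {t<..})"
  by (rule bdd_belowI2[of _ 0]) (use jordan_part_nonneg in auto)

lemma right_distribution_le:
  assumes "0 \<le> t" "t < s" shows "right_distribution G t \<le> G s"
  using assms bdd_below_jordan_part[of t]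
  by (auto simp: right_distribution_def intro!: cINF_lower)

lemma right_distribution_ge:
  assumes "0 \<le> t" shows "G t \<le> right_distribution G t"
proof -
  have "G t \<le> (INF s\<in>{t<..}. G s)"
    by (rule cINF_greatest) (use assms jordan_part_mono in auto)
  then show ?thesis using assms by (simp add: right_distribution_def)
qed

lemma mono_right_distribution: "s \<le> t \<Longrightarrow> right_distribution G s \<le> right_distribution G t"
proof -
  assume "s \<le> t"
  consider "s = t" | "s < t" "0 \<le> s" | "s < 0" "0 \<le> t" | "t < 0"
    using \<open>s \<le> t\<close> by fastforce
  then show ?thesis
  proof cases
    case 2
    then show ?thesis
      using right_distribution_le[of s t] right_distribution_ge[of t] by auto
  next
    case 3
    then show ?thesis
      using right_distribution_ge[of t] jordan_part_nonneg[of t]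
      by (auto simp: right_distribution_def)
  qed (use \<open>s \<le> t\<close> in \<open>auto simp: right_distribution_def\<close>)
qed

lemma right_distribution_eventually_less:
  assumes "0 \<le> t" "right_distribution G t < a"
  shows "\<exists>u>t. \<forall>s. t < s \<and> s < u \<longrightarrow> G s < a \<and> right_distribution G s < a"
proof -
  have "(INF s\<in>{t<..}. G s) < a" using assms by (simp add: right_distribution_def)
  then obtain u where u: "t < u" "G u < a"
    using bdd_below_jordan_part[OF assms(1)] by (subst (asm) cINF_less_iff) auto
  have "G s < a \<and> right_distribution G s < a" if "t < s" "s < u" for s
    using u that assms(1) jordan_part_mono[of s u] right_distribution_le[of s u] by auto
  then show ?thesis using u by blast
qed

lemma tendsto_right_distribution:
  assumes "0 \<le> t" shows "(G \<longlongrightarrow> right_distribution G t) (at_right t)"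
proof (rule order_tendstoI)
  fix a assume "a < right_distribution G t"
  then show "\<forall>\<^sub>F s in at_right t. a < G s"
    using less_le_trans[OF _ right_distribution_le[OF assms]]
    by (auto simp: eventually_at_right_field intro!: exI[of _ "t + 1"])
next
  fix a assume "right_distribution G t < a"
  then show "\<forall>\<^sub>F s in at_right t. G s < a"
    using right_distribution_eventually_less[OF assms, of a]
    unfolding eventually_at_right_field by blast
qed

lemma continuous_right_distribution: "continuous (at_right t) (right_distribution G)"
proof (cases "t < 0")
  case True
  then have "\<forall>\<^sub>F s in at_right t. right_distribution G s = right_distribution G t"
    by (auto simp: eventually_at_right_field right_distribution_def intro!: exI[of _ 0])
  then show ?thesis unfolding continuous_within by (rule tendsto_eventually)
next
  case False
  show ?thesis
    unfolding continuous_within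
  proof (rule order_tendstoI)
    fix a assume a: "a < right_distribution G t"
    have "a < right_distribution G s" if "t < s" for s
      using a mono_right_distribution[of t s] that by auto
    then show "\<forall>\<^sub>F s in at_right t. a < right_distribution G s"
      by (auto simp: eventually_at_right_field intro!: exI[of _ "t + 1"])
  next
    fix a assume "right_distribution G t < a"
    then show "\<forall>\<^sub>F s in at_right t. right_distribution G s < a"
      using right_distribution_eventually_less[of t a] False
      unfolding eventually_at_right_field by (meson not_le)
  qed
qed

lemma emeasure_right_distribution_neg:
  "emeasure (interval_measure (right_distribution G)) {..<0} = 0"
proof -
  let ?M = "interval_measure (right_distribution G)"
  have "{..<0::real} = (\<Union>n::nat. {- real n - 1 <.. - 1 / (real n + 1)})"
  proof (intro equalityI subsetI)
    fix x :: real assume "x \<in> {..<0}"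
    then have x: "x < 0" by simp
    obtain m :: nat where m: "- x < real m" using reals_Archimedean2 by blast
    obtain k :: nat where k: "- 1 / x < real k" using reals_Archimedean2 by blast
    let ?n = "max m k"
    have "- 1 / x < real ?n + 1" using k by linarith
    then have "x \<le> - 1 / (real ?n + 1)" using x by (simp add: field_simps)
    moreover have "- real ?n - 1 < x" using m by linarith
    ultimately show "x \<in> (\<Union>n::nat. {- real n - 1 <.. - 1 / (real n + 1)})" by auto
  next
    fix x :: real assume "x \<in> (\<Union>n::nat. {- real n - 1 <.. - 1 / (real n + 1)})"
    then obtain n :: nat where "x \<le> - 1 / (real n + 1)" by auto
    also have "\<dots> < 0" by (simp add: field_simps)
    finally show "x \<in> {..<0}" by simp
  qed
  moreover have "emeasure ?M (\<Union>n::nat. {- real n - 1 <.. - 1 / (real n + 1)}) = 0"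
  proof (rule emeasure_UN_eq_0)
    fix n :: nat
    have *: "- 1 / (real n + 1) < 0" "- real n - 1 < 0" by (auto simp: field_simps)
    show "emeasure ?M {- real n - 1 <.. - 1 / (real n + 1)} = 0"
      using * by (subst emeasure_interval_measure_Ioc_eq[OF mono_right_distribution
            continuous_right_distribution]) (auto simp: right_distribution_def)
  qed auto
  ultimately show ?thesis by simp
qed

lemma emeasure_right_distribution:
  assumes "0 \<le> t"
  shows "emeasure (interval_measure (right_distribution G)) {0..t} = right_distribution G t"
proof -
  let ?M = "interval_measure (right_distribution G)"
  have null: "{-1<..<0} \<in> null_sets ?M"
    by (rule null_sets_subset[of "{..<0}"])
       (use emeasure_right_distribution_neg in \<open>auto intro: null_setsI\<close>)
  have "{0..t} \<union> {-1<..<0} = {-1<..t}" using assms by auto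
  then have "emeasure ?M {0..t} = emeasure ?M {-1<..t}"
    using emeasure_Un_null_set[OF _ null, of "{0..t}"] by simp
  also have "\<dots> = right_distribution G t"
    using assms by (subst emeasure_interval_measure_Ioc[OF _ mono_right_distribution
          continuous_right_distribution]) (auto simp: right_distribution_def)
  finally show ?thesis .
qed

end

lemma right_distribution_nonneg:
  "jordan_part G \<Longrightarrow> 0 \<le> t \<Longrightarrow> 0 \<le> right_distribution G t"
  using right_distribution_ge[of G t] jordan_part_nonneg[of G t] by linarith

lemma emeasure_stieltjes_neg_half_line:
  assumes "normalized_lbv F"
  shows "emeasure (stieltjes_pos F) {..<0} = 0" "emeasure (stieltjes_neg F) {..<0} = 0"
  using assms
  by (simp_all add: stieltjes_pos_def stieltjes_neg_def emeasure_right_distribution_neg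
      jordan_part_pos_variation jordan_part_neg_variation)

lemma emeasure_stieltjes_finite:
  assumes "normalized_lbv F" "0 \<le> t"
  shows "emeasure (stieltjes_pos F) {0..t} < \<infinity>" "emeasure (stieltjes_neg F) {0..t} < \<infinity>"
  using assms
  by (simp_all add: stieltjes_pos_def stieltjes_neg_def emeasure_right_distribution
      jordan_part_pos_variation jordan_part_neg_variation)

lemma stieltjes_measure_Icc:
  assumes "normalized_lbv F" "0 < t"
  shows "measure (stieltjes_pos F) {0..t} - measure (stieltjes_neg F) {0..t} = F t"
proof -
  note P = jordan_part_pos_variation[OF assms(1)] and N = jordan_part_neg_variation[OF assms(1)]
  let ?p = "right_distribution (pos_variation F) t"
  let ?n = "right_distribution (neg_variation F) t"
  have "((\<lambda>s. pos_variation F s - neg_variation F s) \<longlongrightarrow> ?p - ?n) (at_right t)"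
    using assms(2) by (intro tendsto_diff tendsto_right_distribution P N) auto
  then have "(F \<longlongrightarrow> ?p - ?n) (at_right t)"
    by (simp add: pos_variation_def neg_variation_def field_simps)
  moreover have "(F \<longlongrightarrow> F t) (at_right t)"
    using assms unfolding normalized_lbv_def continuous_within by auto
  ultimately have "?p - ?n = F t"
    by (rule tendsto_unique[rotated]) (simp add: trivial_limit_at_right_real)
  then show ?thesis
    using assms(2) emeasure_right_distribution[OF P, of t] emeasure_right_distribution[OF N, of t]
      right_distribution_nonneg[OF P, of t] right_distribution_nonneg[OF N, of t]
    by (simp add: stieltjes_pos_def stieltjes_neg_def measure_def)
qed

end

theory Submission
  imports Defs
begin

text \<open>
  Fix \<open>t\<close> and let \<open>f(d)\<close> be the integral of \<open>\<langle>d, S(t - \<tau>) q\<rangle>\<close> over \<open>[0,t]\<close> against \<open>F(d\<tau>)\<close>.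
  The integrand is bounded on \<open>[0,t]\<close> and the two Jordan parts of \<open>F(d\<tau>)\<close> are finite there, so
  \<open>f\<close> is a well-defined linear functional. The point is that it is weakly continuous.

  Sequential continuity is what integration theory can deliver: dominated convergence is a
  theorem about sequences and fails for nets. If \<open>d\<^sub>n\<close> tends to \<open>d\<close> weakly, the integrands
  converge pointwise, because for each \<open>\<tau>\<close> the twin property provides an element
  \<open>S(t - \<tau>) q\<close> of \<open>Y\<close> against which \<open>d\<^sub>n\<close> is tested. The dominating constant comes from the
  uniform boundedness principle, applied to the functionals \<open>\<langle>d\<^sub>n, \<cdot>\<rangle>\<close> on the Banach space \<open>Y\<close>,
  together with the fact that the norm of \<open>d\<^sub>n\<close> is the norm of this functional
  (\<open>weakly_convergent_imp_norm_bounded\<close> and \<open>sequentially_continuous_weak_integral\<close>).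

  The hypothesis on \<open>\<sigma>(Y\<^sup>\<diamond>, Y)\<close> upgrades \<open>f\<close> to a continuous functional, and a linear functional
  that is continuous for the weak topology is the pairing with an element of \<open>Y\<close>: it
  vanishes on the common kernel of finitely many pairings and is therefore a linear combination
  of them (\<open>weakly_continuous_linear_functional\<close>).
\<close>

section \<open>The uniform boundedness principle\<close>

text \<open>By Baire, one of the closed sets on which all \<open>L\<^sub>i\<close> are bounded by a fixed \<open>n\<close> contains a
  ball. A small multiple of any vector is the difference of two points of that ball, and this
  turns the bound on the ball into a bound on operator norms.\<close>

lemma uniform_boundedness_principle:
  fixes L :: "'i \<Rightarrow> 'a::banach \<Rightarrow> 'b::real_normed_vector"
  assumes lin: "\<And>i. bounded_linear (L i)"
    and ptw: "\<And>x. bounded (range (\<lambda>i. L i x))"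
  shows "\<exists>K. \<forall>i x. norm (L i x) \<le> K * norm x"
proof -
  define E where "E n = {x. \<forall>i. norm (L i x) \<le> real n}" for n
  have closed: "closed (E n)" for n
  proof -
    have "E n = (\<Inter>i. {x. norm (L i x) \<le> real n})" by (auto simp: E_def)
    moreover have "closed {x. norm (L i x) \<le> real n}" for i
      by (intro closed_Collect_le continuous_intros bounded_linear.continuous_on[OF lin])
    ultimately show ?thesis by auto
  qed
  have cover: "(\<Union>n. E n) = UNIV"
  proof (intro equalityI subsetI UNIV_I)
    fix x
    obtain B where B: "\<And>i. norm (L i x) \<le> B"
      using ptw[of x] by (auto simp: bounded_iff)
    obtain n where "B \<le> real n" using real_arch_simple by blast
    then have "x \<in> E n" using order_trans[OF B] by (simp add: E_def)
    then show "x \<in> (\<Union>n. E n)" by blast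
  qed
  have "\<exists>n. interior (E n) \<noteq> {}"
  proof (rule ccontr)
    assume "\<not> ?thesis"
    then have "euclidean interior_of (\<Union>(range E)) = {}"
      using closed completely_metrizable_space_euclidean by (intro Baire_category_alt) auto
    then show False by (simp add: cover)
  qed
  then obtain n x0 where "x0 \<in> interior (E n)" by blast
  then obtain r where r: "r > 0" "cball x0 r \<subseteq> E n"
    by (meson mem_interior_cball)
  have "norm (L i x) \<le> (2 * real n / r) * norm x" for i x
  proof (cases "x = 0")
    case True
    then show ?thesis using linear_0[OF bounded_linear.linear[OF lin]] by simp
  next
    case False
    define s where "s = r / norm x"
    have s: "s > 0" "s * norm x = r" using False r by (auto simp: s_def)
    have "x0 + s *\<^sub>R x \<in> E n" "x0 \<in> E n"
      using r s by (auto intro!: subsetD[OF r(2)] simp: dist_norm)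
    then have "norm (L i (x0 + s *\<^sub>R x)) \<le> n" "norm (L i x0) \<le> n"
      by (auto simp: E_def)
    moreover have "L i (x0 + s *\<^sub>R x) = L i x0 + s *\<^sub>R L i x"
      using lin[of i] by (simp add: bounded_linear.linear linear_add linear_scale)
    ultimately have "norm (s *\<^sub>R L i x) \<le> 2 * real n"
      by (metis add_diff_cancel_left' add_mono mult_2 norm_triangle_ineq4 order_trans)
    then have "s * norm (L i x) \<le> 2 * real n" using s by simp
    then show ?thesis using s r False by (simp add: s_def field_simps)
  qed
  then show ?thesis by blast
qed

section \<open>Weakly continuous linear functionals\<close>

text \<open>A basic weak neighbourhood of \<open>x\<close> constrains only finitely many pairings, so it contains
  everything that agrees with \<open>x\<close> on them.\<close>

lemma weakly_open_contains_coset: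
  assumes "openin (weak_dual_topology p) U" "x \<in> U"
  shows "\<exists>A. finite A \<and> (\<forall>d. (\<forall>y\<in>A. p d y = p x y) \<longrightarrow> d \<in> U)"
proof -
  have "generate_topology_on {(\<lambda>d. p d y) -` U | y U. open U} U"
    using assms(1) unfolding weak_dual_topology_def by (rule openin_topology_generated_by)
  then show ?thesis using assms(2)
  proof (induction rule: generate_topology_on.induct)
    case (Int a b)
    then obtain A B where "finite A" "\<forall>d. (\<forall>y\<in>A. p d y = p x y) \<longrightarrow> d \<in> a"
      "finite B" "\<forall>d. (\<forall>y\<in>B. p d y = p x y) \<longrightarrow> d \<in> b" by blast
    then show ?case by (intro exI[of _ "A \<union> B"]) auto
  next
    case (UN K)
    then show ?case by (meson UnionE UnionI)
  next
    case (Basis s)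
    then obtain y V where "s = (\<lambda>d. p d y) -` V" by blast
    then show ?case using Basis by (intro exI[of _ "{y}"]) auto
  qed simp
qed

text \<open>Linear algebra only: if \<open>\<langle>\<cdot>, a\<rangle>\<close> does not vanish on the common kernel of the pairings with
  \<open>A\<close>, some \<open>e\<close> in that kernel detects \<open>a\<close>, and subtracting a multiple of \<open>\<langle>\<cdot>, a\<rangle>\<close> chosen to kill
  \<open>f e\<close> reduces \<open>insert a A\<close> to \<open>A\<close>.\<close>

lemma vanishing_on_common_kernel_imp_pairing:
  fixes p :: "'d::real_vector \<Rightarrow> 'y::real_vector \<Rightarrow> real"
  assumes p: "bilinear p" and "finite A" and "linear f"
    and "\<And>d. (\<forall>y\<in>A. p d y = 0) \<Longrightarrow> f d = 0"
  shows "\<exists>u. \<forall>d. f d = p d u"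
  using assms(2-)
proof (induction A arbitrary: f rule: finite_induct)
  case empty
  then show ?case using bilinear_rzero[OF p] by auto
next
  case (insert a A)
  show ?case
  proof (cases "\<exists>e. (\<forall>y\<in>A. p e y = 0) \<and> p e a \<noteq> 0")
    case False
    then show ?thesis using insert.prems by (intro insert.IH) auto
  next
    case True
    then obtain e where e: "\<And>y. y \<in> A \<Longrightarrow> p e y = 0" "p e a \<noteq> 0" by blast
    define c where "c = f e / p e a"
    have "\<exists>u. \<forall>d. f d - c * p d a = p d u"
    proof (rule insert.IH)
      show "linear (\<lambda>d. f d - c * p d a)"
        using insert.prems(1) p
        by (auto intro!: linearI
            simp: linear_add linear_scale bilinear_ladd bilinear_lmul algebra_simps)
    next
      fix d assume d: "\<forall>y\<in>A. p d y = 0"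
      define d' where "d' = d - (p d a / p e a) *\<^sub>R e"
      have "\<forall>y\<in>insert a A. p d' y = 0"
        using d e p by (auto simp: d'_def bilinear_lsub bilinear_lmul)
      then have "f d' = 0" by (rule insert.prems(2))
      then show "f d - c * p d a = 0"
        using insert.prems(1) by (simp add: d'_def c_def linear_diff linear_scale)
    qed
    then obtain u where "\<And>d. f d - c * p d a = p d u" by blast
    then have "f d = p d (u + c *\<^sub>R a)" for d
      using p by (simp add: bilinear_radd bilinear_rmul) (metis add.commute diff_add_cancel)
    then show ?thesis by blast
  qed
qed

lemma weakly_continuous_linear_functional:
  fixes p :: "'d::real_vector \<Rightarrow> 'y::real_normed_vector \<Rightarrow> real"
  assumes p: "bilinear p" and f: "linear f"
    and cont: "continuous_map (weak_dual_topology p) euclideanreal f"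
  shows "\<exists>u. \<forall>d. f d = p d u"
proof -
  have "topspace (weak_dual_topology p) = UNIV"
    by (auto simp: weak_dual_topology_def intro!: exI[of _ UNIV])
  then have "openin (weak_dual_topology p) {d. \<bar>f d\<bar> < 1}"
    using openin_continuous_map_preimage[OF cont, of "{-1<..<1}"] by (simp add: abs_less_iff)
      (smt (verit) Collect_cong)
  then obtain A where A: "finite A" "\<And>d. (\<forall>y\<in>A. p d y = 0) \<Longrightarrow> \<bar>f d\<bar> < 1"
    using weakly_open_contains_coset[of p "{d. \<bar>f d\<bar> < 1}" 0] linear_0[OF f] bilinear_lzero[OF p]
    by auto
  \<comment> \<open>A linear functional that is bounded on a linear subspace vanishes there.\<close>
  have "f d = 0" if d: "\<forall>y\<in>A. p d y = 0" for d
  proof (rule ccontr)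
    assume "f d \<noteq> 0"
    moreover have "\<bar>f ((1 / f d) *\<^sub>R d)\<bar> < 1"
      using d p by (intro A(2)) (simp add: bilinear_lmul)
    ultimately show False using f by (simp add: linear_scale)
  qed
  then show ?thesis
    using vanishing_on_common_kernel_imp_pairing[OF p A(1) f] by blast
qed

section \<open>Weakly convergent sequences\<close>

lemma norming_dual_pair_bounded_bilinear:
  assumes "norming_dual_pair p" shows "bounded_bilinear p"
proof -
  obtain M where p: "bilinear p" and M: "\<And>d y. \<bar>p d y\<bar> \<le> M * norm d * norm y"
    using assms unfolding norming_dual_pair_def by blast
  show ?thesis
  proof
    show "\<exists>K. \<forall>d y. norm (p d y) \<le> norm d * norm y * K"
      using M by (intro exI[of _ M]) (simp add: mult_ac)
  qed (use p in \<open>auto simp: bilinear_ladd bilinear_radd bilinear_lmul bilinear_rmul\<close>)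
qed

lemma norming_dual_pair_norm_left_le:
  fixes p :: "'d::banach \<Rightarrow> 'y::banach \<Rightarrow> real"
  assumes p: "norming_dual_pair p" and B: "\<And>y. \<bar>p d y\<bar> \<le> B * norm y" and "0 \<le> B"
  shows "norm d \<le> B"
proof -
  have "norm d = (SUP y\<in>{y. norm y \<le> 1}. \<bar>p d y\<bar>)"
    using p unfolding norming_dual_pair_def by blast
  also have "\<dots> \<le> B"
  proof (rule cSUP_least)
    fix y :: 'y assume "y \<in> {y. norm y \<le> 1}"
    then show "\<bar>p d y\<bar> \<le> B" using B[of y] mult_left_le[of "norm y" B] \<open>0 \<le> B\<close> by auto
  qed (auto intro: exI[of _ 0])
  finally show ?thesis .
qed

lemma norming_dual_pair_norm_right_le:
  fixes p :: "'d::banach \<Rightarrow> 'y::banach \<Rightarrow> real"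
  assumes p: "norming_dual_pair p" and B: "\<And>d. \<bar>p d y\<bar> \<le> B * norm d" and "0 \<le> B"
  shows "norm y \<le> B"
proof -
  have "norm y = (SUP d\<in>{d. norm d \<le> 1}. \<bar>p d y\<bar>)"
    using p unfolding norming_dual_pair_def by blast
  also have "\<dots> \<le> B"
  proof (rule cSUP_least)
    fix d :: 'd assume "d \<in> {d. norm d \<le> 1}"
    then show "\<bar>p d y\<bar> \<le> B" using B[of d] mult_left_le[of "norm d" B] \<open>0 \<le> B\<close> by auto
  qed (auto intro: exI[of _ 0])
  finally show ?thesis .
qed

lemma weakly_convergent_imp_pairing_tendsto:
  assumes "limitin (weak_dual_topology p) x l sequentially"
  shows "(\<lambda>n. p (x n) y) \<longlonglongrightarrow> p l y"
proof (rule topological_tendstoI)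
  fix V :: "real set" assume V: "open V" "p l y \<in> V"
  have "openin (weak_dual_topology p) ((\<lambda>d. p d y) -` V)"
    unfolding weak_dual_topology_def using V by (intro topology_generated_by_Basis) auto
  then show "\<forall>\<^sub>F n in sequentially. p (x n) y \<in> V"
    using assms V unfolding limitin_def by fastforce
qed

lemma weakly_convergent_imp_norm_bounded:
  fixes p :: "'d::banach \<Rightarrow> 'y::banach \<Rightarrow> real"
  assumes p: "norming_dual_pair p"
    and lim: "limitin (weak_dual_topology p) x l sequentially"
  shows "\<exists>K. \<forall>n. norm (x n) \<le> K"
proof -
  interpret bounded_bilinear p by (rule norming_dual_pair_bounded_bilinear[OF p])
  have "\<exists>K. \<forall>n y. norm (p (x n) y) \<le> K * norm y"
    using convergent_imp_bounded[OF weakly_convergent_imp_pairing_tendsto[OF lim]]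
    by (intro uniform_boundedness_principle bounded_linear_right)
  then obtain K where K: "\<And>n y. \<bar>p (x n) y\<bar> \<le> K * norm y" by auto
  have "norm (x n) \<le> max 0 K" for n
  proof (rule norming_dual_pair_norm_left_le[OF p])
    show "\<bar>p (x n) y\<bar> \<le> max 0 K * norm y" for y
      using K[of n y] mult_right_mono[of K "max 0 K" "norm y"] by simp
  qed simp
  then show ?thesis by blast
qed

section \<open>Weak integrals of bounded paths\<close>

text \<open>For a bounded weakly measurable path \<open>z\<close> in \<open>Y\<close>, the functional \<open>d \<mapsto> \<integral> \<langle>d, z(\<tau>)\<rangle>\<close> is the
  candidate for a weak integral of \<open>z\<close> over \<open>A\<close>. The measure has to be finite on \<open>A\<close> only,
  as the Jordan parts of \<open>F(d\<tau>)\<close>, which may have infinite total mass, are on bounded intervals.\<close>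

context
  fixes p :: "'d::banach \<Rightarrow> 'y::banach \<Rightarrow> real" and M :: "'a measure" and A z C
  assumes p: "norming_dual_pair p"
    and A: "A \<in> sets M" "emeasure M A < \<infinity>"
    and meas: "\<And>d. set_borel_measurable M A (\<lambda>\<tau>. p d (z \<tau>))"
    and bound: "\<And>\<tau>. \<tau> \<in> A \<Longrightarrow> norm (z \<tau>) \<le> C"
begin

interpretation bounded_bilinear p
  by (rule norming_dual_pair_bounded_bilinear[OF p])

lemma set_integrable_weak_path: "set_integrable M A (\<lambda>\<tau>. p d (z \<tau>))"
proof -
  obtain K where K: "K \<ge> 0" "\<And>d y. norm (p d y) \<le> norm d * norm y * K"
    using nonneg_bounded by blast
  have "\<bar>p d (z \<tau>)\<bar> \<le> norm d * C * K" if "\<tau> \<in> A" for \<tau>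
  proof -
    have "\<bar>p d (z \<tau>)\<bar> \<le> norm d * norm (z \<tau>) * K" using K(2)[of d "z \<tau>"] by simp
    also have "\<dots> \<le> norm d * C * K"
      using bound[OF that] K(1) by (intro mult_right_mono mult_left_mono) auto
    finally show ?thesis .
  qed
  then show ?thesis
    using A meas[of d] unfolding set_integrable_def set_borel_measurable_def
    by (intro integrableI_bounded_set[where A = A and B = "norm d * C * K"]) auto
qed

lemma linear_weak_integral: "linear (\<lambda>d. LINT \<tau>:A|M. p d (z \<tau>))"
  by (rule linearI)
     (simp_all add: add_left scaleR_left set_integral_add(2) set_integrable_weak_path)

text \<open>Weak convergence of \<open>x\<^sub>n\<close> gives pointwise convergence of the integrands; its norm
  boundedness gives the dominating constant.\<close>

lemma sequentially_continuous_weak_integral: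
  "sequentially_continuous (weak_dual_topology p) (\<lambda>d. LINT \<tau>:A|M. p d (z \<tau>))"
  unfolding sequentially_continuous_def
proof (intro allI impI)
  fix x l assume lim: "limitin (weak_dual_topology p) x l sequentially"
  obtain K where K: "\<And>n. norm (x n) \<le> K"
    using weakly_convergent_imp_norm_bounded[OF p lim] by blast
  obtain B where B: "B \<ge> 0" "\<And>d y. norm (p d y) \<le> norm d * norm y * B"
    using nonneg_bounded by blast
  have dom: "\<bar>p (x n) (z \<tau>)\<bar> \<le> K * C * B" if "\<tau> \<in> A" for n \<tau>
  proof -
    have "\<bar>p (x n) (z \<tau>)\<bar> \<le> norm (x n) * norm (z \<tau>) * B" using B(2) by simp
    also have "\<dots> \<le> K * C * B"
      using bound[OF that] K[of n] B(1) norm_ge_zero[of "x n"] norm_ge_zero[of "z \<tau>"]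
      by (intro mult_right_mono mult_mono) linarith+
    finally show ?thesis .
  qed
  show "(\<lambda>n. LINT \<tau>:A|M. p (x n) (z \<tau>)) \<longlonglongrightarrow> (LINT \<tau>:A|M. p l (z \<tau>))"
    unfolding set_lebesgue_integral_def
  proof (rule integral_dominated_convergence[where w = "\<lambda>\<tau>. indicator A \<tau> *\<^sub>R (K * C * B)"])
    show "integrable M (\<lambda>\<tau>. indicator A \<tau> *\<^sub>R (K * C * B))"
      using A by (intro integrableI_bounded_set_indicator) auto
    show "AE \<tau> in M. (\<lambda>n. indicator A \<tau> *\<^sub>R p (x n) (z \<tau>)) \<longlonglongrightarrow> indicator A \<tau> *\<^sub>R p l (z \<tau>)"
      by (intro AE_I2 tendsto_scaleR tendsto_const weakly_convergent_imp_pairing_tendsto[OF lim])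
    show "AE \<tau> in M. norm (indicator A \<tau> *\<^sub>R p (x n) (z \<tau>)) \<le> indicator A \<tau> *\<^sub>R (K * C * B)" for n
      using dom[of _ n] by (intro AE_I2) (auto simp: indicator_def)
  qed (use meas in \<open>auto simp: set_borel_measurable_def\<close>)
qed

end

section \<open>Convolution of a twin semigroup orbit with a Stieltjes measure\<close>

text \<open>Each value \<open>S(s) q\<close> lies in \<open>Y\<close> by the twin property, and its norm is controlled by the
  exponential bound because the pairing is norming.\<close>

lemma twin_semigroup_orbit:
  fixes p :: "'d::banach \<Rightarrow> 'y::banach \<Rightarrow> real"
  assumes p: "norming_dual_pair p" and S: "twin_semigroup p S"
  shows "\<exists>v C. \<forall>s\<in>{0..t}. norm (v s) \<le> C \<and> (\<forall>d. S s d q = p d (v s))"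
proof -
  obtain M \<omega> where M: "M \<ge> 1"
    and le: "\<forall>s\<ge>0. \<forall>d y. \<bar>S s d y\<bar> \<le> M * exp (\<omega> * s) * norm y * norm d"
    using S unfolding twin_semigroup_def by (elim conjE exE) (rule that)
  have "\<forall>s\<ge>0. twin_operator p (S s)"
    using S unfolding twin_semigroup_def by (rule conjunct1)
  then have "\<forall>s\<in>{0..t}. \<exists>w. \<forall>d. p d w = S s d q"
    unfolding twin_operator_def by simp
  then obtain v where v: "\<And>s d. s \<in> {0..t} \<Longrightarrow> p d (v s) = S s d q" by metis
  define C where "C = M * exp (\<bar>\<omega>\<bar> * t) * norm q"
  have "norm (v s) \<le> C" if s: "s \<in> {0..t}" for s
  proof (rule norming_dual_pair_norm_right_le[OF p])
    fix d :: 'd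
    have "\<omega> * s \<le> \<bar>\<omega>\<bar> * t"
      using s by (intro mult_mono) auto
    then have "M * exp (\<omega> * s) * norm q * norm d \<le> C * norm d"
      unfolding C_def using M by (intro mult_right_mono mult_left_mono) auto
    then show "\<bar>p d (v s)\<bar> \<le> C * norm d"
      using le[rule_format, of s d q] v[OF s] s by auto
  qed (use M in \<open>simp add: C_def\<close>)
  then show ?thesis using v by metis
qed

theorem lemma8p2:
  fixes p :: "'d::banach \<Rightarrow> 'y::banach \<Rightarrow> real"
    and S :: "real \<Rightarrow> 'd \<Rightarrow> 'y \<Rightarrow> real"
    and q :: 'y
    and F :: "real \<Rightarrow> real"
  assumes "norming_dual_pair p"
    and "twin_semigroup p S"
    and "\<And>f :: 'd \<Rightarrow> real. linear f \<Longrightarrow>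
           sequentially_continuous (weak_dual_topology p) f \<Longrightarrow>
           continuous_map (weak_dual_topology p) euclideanreal f"
    and "normalized_lbv F"
  shows "\<forall>t>0. \<exists>u. \<forall>d. stieltjes_integral F {0..t} (\<lambda>\<tau>. S (t - \<tau>) d q) = p d u"
proof (intro allI impI)
  fix t :: real assume t: "t > 0"
  obtain v C where v: "\<And>s. s \<in> {0..t} \<Longrightarrow> norm (v s) \<le> C"
      "\<And>s d. s \<in> {0..t} \<Longrightarrow> S s d q = p d (v s)"
    using twin_semigroup_orbit[OF assms(1,2)] by metis
  define I where "I M d = (LINT \<tau>:{0..t}|M. p d (v (t - \<tau>)))" for M d
  have I: "linear (I M)" "sequentially_continuous (weak_dual_topology p) (I M)"
    if sets: "sets M = sets borel" and fin: "emeasure M {0..t} < \<infinity>" for M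
  proof -
    have meas: "set_borel_measurable M {0..t} (\<lambda>\<tau>. p d (v (t - \<tau>)))" for d
    proof -
      \<comment> \<open>Measurability is known on the half-line only. The extension by zero can be composed with
        the reflection \<open>\<tau> \<mapsto> t - \<tau>\<close>, and it agrees with the orbit on \<open>[0,t]\<close>.\<close>
      have "(\<lambda>s. S s d q) \<in> borel_measurable (restrict_space borel {0..})"
        using assms(2) unfolding twin_semigroup_def by blast
      then have "(\<lambda>s. indicator {0..} s *\<^sub>R S s d q) \<in> borel_measurable borel"
        by (subst (asm) borel_measurable_restrict_space_iff) auto
      then have [measurable]: "(\<lambda>\<tau>. indicator {0..} (t - \<tau>) *\<^sub>R S (t - \<tau>) d q) \<in> borel_measurable borel"
        by (rule measurable_compose_rev) measurable
      have "(\<lambda>\<tau>. indicator {0..t} \<tau> *\<^sub>R p d (v (t - \<tau>))) =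
            (\<lambda>\<tau>. indicator {0..t} \<tau> *\<^sub>R (indicator {0..} (t - \<tau>) *\<^sub>R S (t - \<tau>) d q))"
        using v(2) by (auto simp: indicator_def fun_eq_iff)
      moreover have "\<dots> \<in> borel_measurable borel" by measurable
      ultimately show ?thesis
        unfolding set_borel_measurable_def by (simp add: measurable_cong_sets[OF sets refl])
    qed
    have v': "norm (v (t - \<tau>)) \<le> C" if "\<tau> \<in> {0..t}" for \<tau>
      using that by (intro v(1)) auto
    have A: "{0..t} \<in> sets M" using sets by simp
    show "linear (I M)" "sequentially_continuous (weak_dual_topology p) (I M)"
      unfolding I_def
      by (rule linear_weak_integral sequentially_continuous_weak_integral; fact)+
  qed
  define f where "f d = I (stieltjes_pos F) d - I (stieltjes_neg F) d" for d
  have pos: "linear (I (stieltjes_pos F))"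
      "sequentially_continuous (weak_dual_topology p) (I (stieltjes_pos F))"
    and neg: "linear (I (stieltjes_neg F))"
      "sequentially_continuous (weak_dual_topology p) (I (stieltjes_neg F))"
    using emeasure_stieltjes_finite[OF assms(4), of t] t
    by (auto intro!: I simp: stieltjes_pos_def stieltjes_neg_def)
  have f: "linear f"
    unfolding f_def[abs_def] by (rule linear_compose_sub[OF pos(1) neg(1)])
  have "sequentially_continuous (weak_dual_topology p) f"
    using pos(2) neg(2) unfolding f_def[abs_def] sequentially_continuous_def
    by (intro allI impI tendsto_diff; blast)
  then have "continuous_map (weak_dual_topology p) euclideanreal f"
    by (rule assms(3)[OF f])
  then obtain u where u: "\<And>d. f d = p d u"
    using weakly_continuous_linear_functional[OF _ f] assms(1)
    unfolding norming_dual_pair_def by blast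
  have "stieltjes_integral F {0..t} (\<lambda>\<tau>. S (t - \<tau>) d q) = f d" for d
    unfolding stieltjes_integral_def f_def I_def set_lebesgue_integral_def
    by (intro arg_cong2[where f = "(-)"] Bochner_Integration.integral_cong refl)
       (auto simp: indicator_def v(2))
  then show "\<exists>u. \<forall>d. stieltjes_integral F {0..t} (\<lambda>\<tau>. S (t - \<tau>) d q) = p d u"
    using u by auto
qed

end
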